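(* If $\operatorname{char} K=p$, then the variety $V$ is a binomial set-theoretic complete intersection; that is, there are $n=\operatorname{codim} V$ binomials in $R$ whose set of common zeros in $K^{2n}$ is exactly $V$.
   Context: Let $K$ be an algebraically closed field and $n\geq 3$ an integer. Let $b_1,\dots,b_{n-2}$ be nonnegative integers, $p$ a prime, and $\ell,a,d,c_1,\dots,c_{n-2}$ positive integers such that: (I) $p$ does not divide any of the $c_i$; (II) $a$ and $d$ are coprime; (III) there are positive integers $g,h$ such that $p^{\ell}=ag+dh$. Let $V\subset K^{2n}$ be the affine simplicial toric variety (of codimension $n$) consisting of all points $(x_1,\dots,x_n,y_1,\dots,y_n)$ of the form $$x_i=u_i\ (1\le i\le n-2),\quad x_{n-1}=u_{n-1}^{p^{\ell}},\quad x_n=u_n^a,$$ $$y_i=u_i^{b_i}u_{n-1}^{c_i}\ (1\le i\le n-2),\quad y_{n-1}=u_n^d,\quad y_n=u_{n-1}u_n,$$ with $(u_1,\dots,u_n)\in K^n$ (with the convention $u^0=1$). Let $R=K[x_1,\dots,x_n,y_1,\dots,y_n]$. A monomial is a product of indeterminates, and a binomial is a difference of two distinct monomials. *)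

theory Defs
  imports
    "HOL-Computational_Algebra.Computational_Algebra"
    "HOL-Library.Poly_Mapping"
    "HOL-Library.Extended_Nat"
    "HOL-Library.FuncSet"
begin

section \<open>Multivariate polynomials and affine algebraic sets\<close>

text \<open>
  For a set \<open>I\<close> of coordinates, affine space \<open>K\<^sup>I\<close> is the set of extensional functions
  from \<open>I\<close> to \<open>K\<close>, so that points are determined by their coordinates in \<open>I\<close>.
  A polynomial is a finitely supported map from exponent vectors to coefficients; the ring
  operations are those of \<^theory>\<open>HOL-Library.Poly_Mapping\<close>.
\<close>

definition affine_space :: "'v set \<Rightarrow> ('v \<Rightarrow> 'k) set" where
  "affine_space I = I \<rightarrow>\<^sub>E UNIV"

type_synonym ('v, 'k) mpoly = "('v \<Rightarrow>\<^sub>0 nat) \<Rightarrow>\<^sub>0 'k"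

definition poly_ring :: "'v set \<Rightarrow> ('v, 'k::comm_ring_1) mpoly set" where
  "poly_ring I = {f. \<forall>m \<in> Poly_Mapping.keys f. Poly_Mapping.keys m \<subseteq> I}"

definition mpoly_eval :: "('v \<Rightarrow> 'k) \<Rightarrow> ('v, 'k::comm_ring_1) mpoly \<Rightarrow> 'k" where
  "mpoly_eval x f =
     (\<Sum>m \<in> Poly_Mapping.keys f. Poly_Mapping.lookup f m *
        (\<Prod>v \<in> Poly_Mapping.keys m. x v ^ Poly_Mapping.lookup m v))"

definition monomials :: "'v set \<Rightarrow> ('v, 'k::comm_ring_1) mpoly set" where
  "monomials I = {Poly_Mapping.single m 1 | m. Poly_Mapping.keys m \<subseteq> I}"

definition binomials :: "'v set \<Rightarrow> ('v, 'k::comm_ring_1) mpoly set" where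
  "binomials I = {M - N | M N. M \<in> monomials I \<and> N \<in> monomials I \<and> M \<noteq> N}"

definition zero_locus :: "'v set \<Rightarrow> ('v, 'k::comm_ring_1) mpoly set \<Rightarrow> ('v \<Rightarrow> 'k) set" where
  "zero_locus I S = {x \<in> affine_space I. \<forall>f \<in> S. mpoly_eval x f = 0}"

definition zariski_closed :: "'v set \<Rightarrow> ('v \<Rightarrow> 'k::comm_ring_1) set \<Rightarrow> bool" where
  "zariski_closed I Z \<longleftrightarrow> (\<exists>S \<subseteq> poly_ring I. Z = zero_locus I S)"

definition irreducible_closed :: "'v set \<Rightarrow> ('v \<Rightarrow> 'k::comm_ring_1) set \<Rightarrow> bool" where
  "irreducible_closed I Z \<longleftrightarrow>
     zariski_closed I Z \<and> Z \<noteq> {} \<and>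
     (\<forall>A B. zariski_closed I A \<longrightarrow> zariski_closed I B \<longrightarrow> Z = A \<union> B \<longrightarrow> A = Z \<or> B = Z)"

text \<open>
  The dimension is the combinatorial (Krull) dimension of the Zariski topology: the supremum of
  the lengths \<open>m\<close> of chains \<open>Z 0 \<subset> Z 1 \<subset> \<dots> \<subset> Z m\<close> of irreducible closed subsets of \<open>V\<close>.
  It is meant for Zariski closed \<open>V\<close>, for which the closed subsets of \<open>V\<close> are the closed
  sets contained in \<open>V\<close>.
\<close>

definition variety_dim :: "'v set \<Rightarrow> ('v \<Rightarrow> 'k::comm_ring_1) set \<Rightarrow> enat" where
  "variety_dim I V =
     Sup {enat m | m. \<exists>Z :: nat \<Rightarrow> ('v \<Rightarrow> 'k) set.
            (\<forall>i \<le> m. irreducible_closed I (Z i) \<and> Z i \<subseteq> V) \<and>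
            (\<forall>i < m. Z i \<subset> Z (Suc i))}"

definition variety_codim :: "'v set \<Rightarrow> ('v \<Rightarrow> 'k::comm_ring_1) set \<Rightarrow> enat" where
  "variety_codim I V = enat (card I) - variety_dim I V"

definition binomial_set_theoretic_complete_intersection ::
    "'v set \<Rightarrow> ('v \<Rightarrow> 'k::comm_ring_1) set \<Rightarrow> bool" where
  "binomial_set_theoretic_complete_intersection I V \<longleftrightarrow>
     (\<exists>B \<subseteq> binomials I. finite B \<and> enat (card B) = variety_codim I V \<and> zero_locus I B = V)"

section \<open>The toric variety\<close>

datatype coord = X nat | Y nat

definition coords :: "nat \<Rightarrow> coord set" where
  "coords n = X ` {1..n} \<union> Y ` {1..n}"

definition toric_point ::
    "nat \<Rightarrow> nat \<Rightarrow> nat \<Rightarrow> nat \<Rightarrow> nat \<Rightarrow> (nat \<Rightarrow> nat) \<Rightarrow> (nat \<Rightarrow> nat) \<Rightarrow>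
     (nat \<Rightarrow> 'k::comm_ring_1) \<Rightarrow> (coord \<Rightarrow> 'k)" where
  "toric_point n p l a d b c u =
     (\<lambda>v \<in> coords n. case v of
        X i \<Rightarrow> if i \<le> n - 2 then u i
               else if i = n - 1 then u (n - 1) ^ (p ^ l)
               else u n ^ a
      | Y i \<Rightarrow> if i \<le> n - 2 then u i ^ b i * u (n - 1) ^ c i
               else if i = n - 1 then u n ^ d
               else u (n - 1) * u n)"

definition toric_variety ::
    "nat \<Rightarrow> nat \<Rightarrow> nat \<Rightarrow> nat \<Rightarrow> nat \<Rightarrow> (nat \<Rightarrow> nat) \<Rightarrow> (nat \<Rightarrow> nat) \<Rightarrow>
     (coord \<Rightarrow> 'k::comm_ring_1) set" where
  "toric_variety n p l a d b c = toric_point n p l a d b c ` affine_space {1..n}"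

end

theory Submission
  imports Defs
begin

text \<open>
  Put \<open>q = p\<^sup>l\<close>. The binomials are \<open>y\<^sub>i\<^sup>q - x\<^sub>i\<^bsup>b\<^sub>i q\<^esup> x\<^sub>n\<^sub>-\<^sub>1\<^bsup>c\<^sub>i\<^esup>\<close> for \<open>i \<le> n - 2\<close>,
  \<open>y\<^sub>n\<^sub>-\<^sub>1\<^sup>a - x\<^sub>n\<^sup>d\<close> and \<open>y\<^sub>n\<^sup>q - x\<^sub>n\<^sub>-\<^sub>1 x\<^sub>n\<^sup>g y\<^sub>n\<^sub>-\<^sub>1\<^sup>h\<close>. A common zero determines \<open>u\<^sub>n\<close> by coprimality
  of \<open>a\<close> and \<open>d\<close>, and each remaining parametric equation holds after raising to the \<open>q\<close>-th power,
  hence holds because the Frobenius is injective.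

  The images of the coordinate subspaces of \<open>K\<^sup>n\<close> form a chain of irreducible closed subsets of \<open>V\<close>
  of length \<open>n\<close>. Conversely, in a chain \<open>Z\<^sub>0 \<subset> \<dots> \<subset> Z\<^sub>m\<close> polynomials \<open>F\<^sub>i\<close> that vanish
  on \<open>Z\<^sub>i\<close> but not on \<open>Z\<^sub>i\<^sub>+\<^sub>1\<close> are algebraically independent on \<open>Z\<^sub>m\<close>; pulled back to \<open>K\<^sup>n\<close> they
  are \<open>m\<close> independent polynomials in \<open>n\<close> variables, so \<open>m \<le> n\<close>.
\<close>

section \<open>Polynomial functions\<close>

definition monomial_fun :: "'v set \<Rightarrow> ('v \<Rightarrow> nat) \<Rightarrow> ('v \<Rightarrow> 'k::comm_ring_1) \<Rightarrow> 'k" where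
  "monomial_fun I e u = (\<Prod>i\<in>I. u i ^ e i)"

text \<open>The bound is on the exponent of each variable separately, so for finite \<open>I\<close>
  the functions with bound \<open>D\<close> are spanned by \<open>(D + 1) ^ card I\<close>
  monomials. The dimension count in \<open>alg_dependent_on_polyfuns\<close> rests on this
  number.\<close>

definition bounded_polyfun :: "'v set \<Rightarrow> nat \<Rightarrow> (('v \<Rightarrow> 'k::comm_ring_1) \<Rightarrow> 'k) \<Rightarrow> bool" where
  "bounded_polyfun I D f \<longleftrightarrow>
     (\<exists>c. \<forall>u. f u = (\<Sum>e \<in> I \<rightarrow>\<^sub>E {..D}. c e * monomial_fun I e u))"

definition polyfun :: "'v set \<Rightarrow> (('v \<Rightarrow> 'k::comm_ring_1) \<Rightarrow> 'k) \<Rightarrow> bool" where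
  "polyfun I f \<longleftrightarrow> (\<exists>D. bounded_polyfun I D f)"

lemma monomial_fun_restrict [simp]: "monomial_fun I (restrict e I) u = monomial_fun I e u"
  by (simp add: monomial_fun_def)

lemma bounded_polyfun_add:
  assumes "bounded_polyfun I D f" "bounded_polyfun I D g"
  shows "bounded_polyfun I D (\<lambda>u. f u + g u)"
proof -
  obtain c1 c2 where "\<forall>u. f u = (\<Sum>e \<in> I \<rightarrow>\<^sub>E {..D}. c1 e * monomial_fun I e u)"
    "\<forall>u. g u = (\<Sum>e \<in> I \<rightarrow>\<^sub>E {..D}. c2 e * monomial_fun I e u)"
    using assms unfolding bounded_polyfun_def by blast
  then show ?thesis
    unfolding bounded_polyfun_def
    by (intro exI[of _ "\<lambda>e. c1 e + c2 e"]) (simp add: sum.distrib distrib_right)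
qed

lemma bounded_polyfun_scale:
  assumes "bounded_polyfun I D f"
  shows "bounded_polyfun I D (\<lambda>u. a * f u)"
proof -
  obtain c where "\<forall>u. f u = (\<Sum>e \<in> I \<rightarrow>\<^sub>E {..D}. c e * monomial_fun I e u)"
    using assms unfolding bounded_polyfun_def by blast
  then show ?thesis
    unfolding bounded_polyfun_def
    by (intro exI[of _ "\<lambda>e. a * c e"]) (simp add: sum_distrib_left mult.assoc)
qed

lemma bounded_polyfun_0: "bounded_polyfun I D (\<lambda>u. 0)"
  unfolding bounded_polyfun_def by (intro exI[of _ "\<lambda>e. 0"]) simp

lemma bounded_polyfun_sum:
  assumes "\<And>a. a \<in> A \<Longrightarrow> bounded_polyfun I D (f a)"
  shows "bounded_polyfun I D (\<lambda>u. \<Sum>a\<in>A. f a u)"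
  using assms
  by (induction A rule: infinite_finite_induct)
     (auto intro: bounded_polyfun_add bounded_polyfun_0)

lemma bounded_polyfun_monomial:
  assumes "finite I" "\<And>i. i \<in> I \<Longrightarrow> e i \<le> D"
  shows "bounded_polyfun I D (monomial_fun I e)"
  unfolding bounded_polyfun_def
proof (intro exI allI)
  fix u :: "'a \<Rightarrow> 'b"
  have fin: "finite (I \<rightarrow>\<^sub>E {..D})" and mem: "restrict e I \<in> I \<rightarrow>\<^sub>E {..D}"
    using assms by (auto intro: finite_PiE)
  have "(\<Sum>e' \<in> I \<rightarrow>\<^sub>E {..D}. of_bool (e' = restrict e I) * monomial_fun I e' u)
      = (\<Sum>e' \<in> I \<rightarrow>\<^sub>E {..D}. if e' = restrict e I then monomial_fun I e' u else 0)"
    by (intro sum.cong) auto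
  also have "\<dots> = monomial_fun I e u"
    using fin mem by (simp add: sum.delta)
  finally show "monomial_fun I e u
      = (\<Sum>e' \<in> I \<rightarrow>\<^sub>E {..D}. of_bool (e' = restrict e I) * monomial_fun I e' u)" ..
qed

lemma bounded_polyfun_mono:
  assumes "finite I" "bounded_polyfun I D f" "D \<le> D'"
  shows "bounded_polyfun I D' f"
proof -
  obtain c where "\<And>u. f u = (\<Sum>e \<in> I \<rightarrow>\<^sub>E {..D}. c e * monomial_fun I e u)"
    using assms(2) unfolding bounded_polyfun_def by blast
  then have *: "f = (\<lambda>u. \<Sum>e \<in> I \<rightarrow>\<^sub>E {..D}. c e * monomial_fun I e u)" by auto
  show ?thesis
    unfolding *
  proof (intro bounded_polyfun_sum bounded_polyfun_scale bounded_polyfun_monomial assms(1))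
    fix e i assume "e \<in> I \<rightarrow>\<^sub>E {..D}" "i \<in> I"
    then have "e i \<in> {..D}" by (rule PiE_mem)
    then show "e i \<le> D'" using assms(3) by simp
  qed
qed

lemma bounded_polyfun_mult:
  assumes "finite I" "bounded_polyfun I D f" "bounded_polyfun I D' g"
  shows "bounded_polyfun I (D + D') (\<lambda>u. f u * g u)" (is ?goal)
proof -
  obtain c1 c2 where c: "\<And>u. f u = (\<Sum>e \<in> I \<rightarrow>\<^sub>E {..D}. c1 e * monomial_fun I e u)"
    "\<And>u. g u = (\<Sum>e \<in> I \<rightarrow>\<^sub>E {..D'}. c2 e * monomial_fun I e u)"
    using assms unfolding bounded_polyfun_def by blast
  have mono: "monomial_fun I e u * monomial_fun I e' u = monomial_fun I (\<lambda>i. e i + e' i) u"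
    for e e' and u :: "'a \<Rightarrow> 'b"
    by (simp add: monomial_fun_def power_add prod.distrib)
  have "(\<lambda>u. f u * g u) = (\<lambda>u. \<Sum>e \<in> I \<rightarrow>\<^sub>E {..D}. \<Sum>e' \<in> I \<rightarrow>\<^sub>E {..D'}.
          (c1 e * c2 e') * monomial_fun I (\<lambda>i. e i + e' i) u)"
    unfolding c sum_product mono[symmetric] by (simp only: mult_ac)
  moreover have "bounded_polyfun I (D + D') \<dots>"
  proof (intro bounded_polyfun_sum bounded_polyfun_scale bounded_polyfun_monomial assms(1))
    fix e e' i assume "e \<in> I \<rightarrow>\<^sub>E {..D}" "e' \<in> I \<rightarrow>\<^sub>E {..D'}" "i \<in> I"
    then have "e i \<in> {..D}" "e' i \<in> {..D'}" by (metis PiE_mem)+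
    then show "e i + e' i \<le> D + D'" by simp
  qed
  ultimately show ?goal by (simp only:)
qed

lemma bounded_polyfun_const:
  assumes "finite I"
  shows "bounded_polyfun I D (\<lambda>u. a)"
  using bounded_polyfun_scale[OF bounded_polyfun_monomial[OF assms, of "\<lambda>_. 0" D], of a]
  by (simp add: monomial_fun_def)

lemma bounded_polyfun_prod:
  assumes "finite I" "\<And>a. a \<in> A \<Longrightarrow> bounded_polyfun I D (f a)"
  shows "bounded_polyfun I (card A * D) (\<lambda>u. \<Prod>a\<in>A. f a u)"
  using assms(2)
proof (induction A rule: infinite_finite_induct)
  case (insert x A)
  then have "bounded_polyfun I (D + card A * D) (\<lambda>u. f x u * (\<Prod>a\<in>A. f a u))"
    by (intro bounded_polyfun_mult assms(1)) auto
  then show ?case using insert by simp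
qed (auto intro: bounded_polyfun_const assms(1))

lemma bounded_polyfun_power:
  assumes "finite I" "bounded_polyfun I D f"
  shows "bounded_polyfun I (k * D) (\<lambda>u. f u ^ k)"
  using bounded_polyfun_prod[of I "{..<k}" D "\<lambda>_. f"] assms by simp

section \<open>Closure properties of polynomial functions without a degree bound\<close>

lemma polyfun_const: "finite I \<Longrightarrow> polyfun I (\<lambda>u. a)"
  unfolding polyfun_def by (intro exI bounded_polyfun_const)

lemma polyfun_add:
  assumes "finite I" "polyfun I f" "polyfun I g"
  shows "polyfun I (\<lambda>u. f u + g u)"
proof -
  obtain D D' where "bounded_polyfun I D f" "bounded_polyfun I D' g"
    using assms unfolding polyfun_def by blast
  then have "bounded_polyfun I (max D D') f" "bounded_polyfun I (max D D') g"
    by (auto intro: bounded_polyfun_mono[OF assms(1)])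
  then show ?thesis unfolding polyfun_def by (intro exI bounded_polyfun_add)
qed

lemma polyfun_mult:
  assumes "finite I" "polyfun I f" "polyfun I g"
  shows "polyfun I (\<lambda>u. f u * g u)"
proof -
  obtain D D' where "bounded_polyfun I D f" "bounded_polyfun I D' g"
    using assms unfolding polyfun_def by auto
  then show ?thesis
    unfolding polyfun_def by (intro exI[of _ "D + D'"] bounded_polyfun_mult assms(1))
qed

lemma polyfun_power: "finite I \<Longrightarrow> polyfun I f \<Longrightarrow> polyfun I (\<lambda>u. f u ^ k)"
  by (induction k) (auto intro: polyfun_mult polyfun_const)

lemma polyfun_sum:
  assumes "finite I" "\<And>a. a \<in> A \<Longrightarrow> polyfun I (f a)"
  shows "polyfun I (\<lambda>u. \<Sum>a\<in>A. f a u)"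
  using assms(2)
  by (induction A rule: infinite_finite_induct)
     (auto intro: polyfun_add polyfun_const assms(1))

lemma polyfun_prod:
  assumes "finite I" "\<And>a. a \<in> A \<Longrightarrow> polyfun I (f a)"
  shows "polyfun I (\<lambda>u. \<Prod>a\<in>A. f a u)"
  using assms(2)
  by (induction A rule: infinite_finite_induct)
     (auto intro: polyfun_mult polyfun_const assms(1))

lemma polyfun_coordinate:
  assumes "finite I" "i \<in> I"
  shows "polyfun I (\<lambda>u. u i :: 'b :: comm_ring_1)"
proof -
  have "monomial_fun I (\<lambda>j. of_bool (j = i)) = (\<lambda>u. u i :: 'b)"
  proof
    fix u :: "'a \<Rightarrow> 'b"
    have "monomial_fun I (\<lambda>j. of_bool (j = i)) u = (\<Prod>j\<in>I. if j = i then u j else 1)"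
      unfolding monomial_fun_def by (intro prod.cong) auto
    then show "monomial_fun I (\<lambda>j. of_bool (j = i)) u = u i" using assms by simp
  qed
  moreover have "bounded_polyfun I 1 (monomial_fun I (\<lambda>j. of_bool (j = i)) :: _ \<Rightarrow> 'b)"
    by (rule bounded_polyfun_monomial[OF assms(1)]) auto
  ultimately show ?thesis unfolding polyfun_def by auto
qed

lemma polyfun_compose:
  assumes "finite I" "finite J" "polyfun J f" "\<And>j. j \<in> J \<Longrightarrow> polyfun I (\<lambda>u. \<phi> u j)"
  shows "polyfun I (\<lambda>u. f (\<phi> u))"
proof -
  obtain D c where c: "\<And>x. f x = (\<Sum>e \<in> J \<rightarrow>\<^sub>E {..D}. c e * monomial_fun J e x)"
    using assms(3) unfolding polyfun_def bounded_polyfun_def by blast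
  show ?thesis
    unfolding c monomial_fun_def
    by (intro polyfun_sum polyfun_mult polyfun_const polyfun_prod polyfun_power assms)
qed

section \<open>Evaluation of formal polynomials\<close>

lemma mpoly_eval_superset:
  assumes "finite A" "Poly_Mapping.keys f \<subseteq> A"
  shows "mpoly_eval x f = (\<Sum>m\<in>A. Poly_Mapping.lookup f m *
           (\<Prod>v\<in>Poly_Mapping.keys m. x v ^ Poly_Mapping.lookup m v))"
  unfolding mpoly_eval_def using assms
  by (intro sum.mono_neutral_left) (auto simp: in_keys_iff)

lemma mpoly_eval_add: "mpoly_eval x (f + g) = mpoly_eval x f + mpoly_eval x g"
proof -
  let ?A = "Poly_Mapping.keys f \<union> Poly_Mapping.keys g"
  have "finite ?A" by simp
  then show ?thesis
    by (simp add: mpoly_eval_superset[of ?A] keys_add lookup_add distrib_right sum.distrib)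
qed

lemma mpoly_eval_minus: "mpoly_eval x (f - g) = mpoly_eval x f - mpoly_eval x g"
  using mpoly_eval_add[of x "f - g" g] by simp

lemma mpoly_eval_sum: "mpoly_eval x (\<Sum>a\<in>A. f a) = (\<Sum>a\<in>A. mpoly_eval x (f a))"
proof -
  have "mpoly_eval x 0 = 0" by (simp add: mpoly_eval_def)
  then show ?thesis
    by (induction A rule: infinite_finite_induct) (simp_all add: mpoly_eval_add)
qed

lemma mpoly_eval_single:
  "mpoly_eval x (Poly_Mapping.single m c) =
     c * (\<Prod>v\<in>Poly_Mapping.keys m. x v ^ Poly_Mapping.lookup m v)"
  by (simp add: mpoly_eval_superset[of "{m}"])

lemma mpoly_eval_single_superset:
  assumes "finite A" "Poly_Mapping.keys m \<subseteq> A"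
  shows "mpoly_eval x (Poly_Mapping.single m c) =
     c * (\<Prod>v\<in>A. x v ^ Poly_Mapping.lookup m v)"
  unfolding mpoly_eval_single using assms
  by (subst prod.mono_neutral_left[of A "Poly_Mapping.keys m"]) (auto simp: in_keys_iff)

lemma mpoly_eval_single_add:
  "mpoly_eval x (Poly_Mapping.single (m + m') 1) =
     mpoly_eval x (Poly_Mapping.single m 1) * mpoly_eval x (Poly_Mapping.single m' 1)"
proof -
  let ?A = "Poly_Mapping.keys m \<union> Poly_Mapping.keys m'"
  have "finite ?A" by simp
  then show ?thesis
    by (simp add: mpoly_eval_single_superset[of ?A] keys_add lookup_add power_add prod.distrib)
qed

lemma mpoly_eval_single_single:
  "mpoly_eval x (Poly_Mapping.single (Poly_Mapping.single v k) 1) = x v ^ k"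
  by (simp add: mpoly_eval_single_superset[of "{v}"])

lemma polyfun_mpoly_eval:
  assumes "finite I" "f \<in> poly_ring I"
  shows "polyfun I (\<lambda>x. mpoly_eval x f)"
  unfolding mpoly_eval_def
proof (intro polyfun_sum polyfun_mult polyfun_const polyfun_prod polyfun_power assms(1))
  fix m v assume "m \<in> Poly_Mapping.keys f" "v \<in> Poly_Mapping.keys m"
  then show "polyfun I (\<lambda>x. x v)"
    using assms by (intro polyfun_coordinate) (auto simp: poly_ring_def)
qed

text \<open>Closed sets are defined by formal polynomials, while the arguments below construct
  functions. This passage back lets a polynomial function cut out a closed set.\<close>

lemma polyfun_imp_mpoly_eval:
  assumes "finite I" "polyfun I f"
  shows "\<exists>q \<in> poly_ring I. \<forall>x. mpoly_eval x q = f x"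
proof -
  obtain D c where c: "\<And>x. f x = (\<Sum>e \<in> I \<rightarrow>\<^sub>E {..D}. c e * monomial_fun I e x)"
    using assms(2) unfolding polyfun_def bounded_polyfun_def by blast
  \<comment> \<open>An extensional \<open>e\<close> is \<open>undefined\<close> outside
    \<open>I\<close>, so the exponents there are reset to 0, which also makes the support
    finite.\<close>
  define m :: "('a \<Rightarrow> nat) \<Rightarrow> 'a \<Rightarrow>\<^sub>0 nat" where
    "m e = Abs_poly_mapping (\<lambda>i. if i \<in> I then e i else 0)" for e
  have lookup: "Poly_Mapping.lookup (m e) = (\<lambda>i. if i \<in> I then e i else 0)" for e
    unfolding m_def using assms(1) by (subst lookup_Abs_poly_mapping) auto
  then have keys: "Poly_Mapping.keys (m e) \<subseteq> I" for e
    by (auto simp: in_keys_iff split: if_splits)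
  define q where "q = (\<Sum>e \<in> I \<rightarrow>\<^sub>E {..D}. Poly_Mapping.single (m e) (c e))"
  have "Poly_Mapping.keys q \<subseteq> (\<Union>e \<in> I \<rightarrow>\<^sub>E {..D}. Poly_Mapping.keys (Poly_Mapping.single (m e) (c e)))"
    unfolding q_def by (rule keys_sum)
  then have "q \<in> poly_ring I"
    using keys by (force simp: poly_ring_def split: if_splits)
  moreover have "mpoly_eval x q = f x" for x
    unfolding q_def mpoly_eval_sum c monomial_fun_def
    by (simp add: mpoly_eval_single_superset[OF assms(1) keys] lookup cong: prod.cong)
  ultimately show ?thesis by blast
qed

section \<open>Zero loci and the prime property of irreducible closed sets\<close>

lemma zero_locus_insert:
  "zero_locus I (insert f S) = {x \<in> zero_locus I S. mpoly_eval x f = 0}"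
  by (auto simp: zero_locus_def)

lemma zariski_closed_zero_locus: "S \<subseteq> poly_ring I \<Longrightarrow> zariski_closed I (zero_locus I S)"
  by (auto simp: zariski_closed_def)

text \<open>If \<open>f g\<close> vanishes on \<open>Z\<close>, then \<open>Z\<close> is the union of its closed subsets \<open>f = 0\<close> and \<open>g = 0\<close>.\<close>

lemma irreducible_closed_prime:
  assumes "finite I" "irreducible_closed I Z" "polyfun I f" "polyfun I g"
    and "\<And>x. x \<in> Z \<Longrightarrow> f x * g x = (0 :: 'k :: idom)"
  shows "(\<forall>x\<in>Z. f x = 0) \<or> (\<forall>x\<in>Z. g x = 0)"
proof -
  obtain S where S: "S \<subseteq> poly_ring I" "Z = zero_locus I S"
    using assms(2) by (auto simp: irreducible_closed_def zariski_closed_def)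
  obtain p q where p: "p \<in> poly_ring I" "\<And>x. mpoly_eval x p = f x"
    and q: "q \<in> poly_ring I" "\<And>x. mpoly_eval x q = g x"
    using polyfun_imp_mpoly_eval[OF assms(1)] assms(3,4) by metis
  let ?A = "zero_locus I (insert p S)" and ?B = "zero_locus I (insert q S)"
  have "Z = ?A \<union> ?B"
    using assms(5) unfolding zero_locus_insert S(2) p(2) q(2) mult_eq_0_iff by blast
  moreover have "zariski_closed I ?A" "zariski_closed I ?B"
    using S(1) p(1) q(1) by (auto intro!: zariski_closed_zero_locus)
  ultimately have "?A = Z \<or> ?B = Z"
    using assms(2) unfolding irreducible_closed_def by blast
  then show ?thesis
    unfolding zero_locus_insert S(2) p(2) q(2) by blast
qed

section \<open>Algebraic dependence\<close>

text \<open>Gaussian elimination: each induction step removes one equation \<open>t\<close> and, if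
  \<open>t\<close> is nontrivial, one unknown \<open>e0\<close> with a nonzero coefficient in
  it.\<close>

lemma homogeneous_system_solvable:
  fixes M :: "'e \<Rightarrow> 't \<Rightarrow> 'k::field"
  assumes "finite T" "finite E" "card T < card E"
  shows "\<exists>\<alpha>. (\<exists>e\<in>E. \<alpha> e \<noteq> 0) \<and> (\<forall>t\<in>T. (\<Sum>e\<in>E. \<alpha> e * M e t) = 0)"
  using assms
proof (induction T arbitrary: E M rule: finite_induct)
  case empty
  then obtain e where "e \<in> E" by fastforce
  then show ?case by (intro exI[of _ "\<lambda>_. 1"]) auto
next
  case (insert t T)
  show ?case
  proof (cases "\<forall>e\<in>E. M e t = 0")
    case True
    obtain \<alpha> where "\<exists>e\<in>E. \<alpha> e \<noteq> 0" "\<forall>s\<in>T. (\<Sum>e\<in>E. \<alpha> e * M e s) = 0"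
      using insert.IH[of E M] insert.prems insert.hyps by auto
    then show ?thesis using True by (intro exI[of _ \<alpha>]) auto
  next
    case False
    then obtain e0 where e0: "e0 \<in> E" "M e0 t \<noteq> 0" by blast
    \<comment> \<open>Coefficients after substituting for the unknown \<open>e0\<close> by means of
      equation \<open>t\<close>.\<close>
    define M' where "M' e s = M e s - M e t / M e0 t * M e0 s" for e s
    have "card T < card (E - {e0})"
      using insert.prems insert.hyps e0 by (simp add: card_Diff_singleton)
    then obtain \<alpha> where \<alpha>: "\<exists>e\<in>E - {e0}. \<alpha> e \<noteq> 0"
        "\<forall>s\<in>T. (\<Sum>e\<in>E - {e0}. \<alpha> e * M' e s) = 0"
      using insert.IH[of "E - {e0}" M'] insert.prems by blast
    \<comment> \<open>The value of the unknown \<open>e0\<close> that equation \<open>t\<close>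
      forces once the others are given by \<open>\<alpha>\<close>.\<close>
    define z where "z = - (\<Sum>e\<in>E - {e0}. \<alpha> e * M e t) / M e0 t"
    define \<beta> where "\<beta> e = (if e = e0 then z else \<alpha> e)" for e
    have eq: "(\<Sum>e\<in>E. \<beta> e * M e s) = z * M e0 s + (\<Sum>e\<in>E - {e0}. \<alpha> e * M e s)" for s
    proof -
      have "(\<Sum>e\<in>E. \<beta> e * M e s) = \<beta> e0 * M e0 s + (\<Sum>e\<in>E - {e0}. \<beta> e * M e s)"
        using insert.prems e0 by (simp add: sum.remove)
      also have "(\<Sum>e\<in>E - {e0}. \<beta> e * M e s) = (\<Sum>e\<in>E - {e0}. \<alpha> e * M e s)"
        by (intro sum.cong) (auto simp: \<beta>_def)
      finally show ?thesis by (simp add: \<beta>_def)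
    qed
    have "(\<Sum>e\<in>E. \<beta> e * M e s) = 0" if "s \<in> insert t T" for s
    proof (cases "s = t")
      case True
      then show ?thesis unfolding eq z_def using e0 by simp
    next
      case False
      have "(\<Sum>e\<in>E - {e0}. \<alpha> e * M e s)
          = (\<Sum>e\<in>E - {e0}. \<alpha> e * M' e s) + (\<Sum>e\<in>E - {e0}. \<alpha> e * M e t) / M e0 t * M e0 s"
        unfolding M'_def sum_divide_distrib sum_distrib_right sum.distrib[symmetric]
        by (intro sum.cong) (auto simp: algebra_simps)
      then show ?thesis unfolding eq z_def using \<alpha>(2) False that by simp
    qed
    moreover have "\<exists>e\<in>E. \<beta> e \<noteq> 0" using \<alpha>(1) by (auto simp: \<beta>_def)
    ultimately show ?thesis by blast
  qed
qed

text \<open>\<open>A\<close> is the exact support of the relation: all coefficients on it are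
  nonzero, so nonemptiness of \<open>A\<close> says that the relation is nontrivial. Exponent
  vectors are extended by 0 from \<open>d\<close> on. For \<open>d = 0\<close> the relation is a
  nonzero constant, so dependence means that \<open>Z\<close> is empty.\<close>

definition alg_dependent_on :: "'a set \<Rightarrow> nat \<Rightarrow> (nat \<Rightarrow> 'a \<Rightarrow> 'k::comm_ring_1) \<Rightarrow> bool" where
  "alg_dependent_on Z d F \<longleftrightarrow>
     (\<exists>A \<alpha>. finite A \<and> A \<noteq> {} \<and> A \<subseteq> {e :: nat \<Rightarrow> nat. \<forall>i\<ge>d. e i = 0} \<and>
        (\<forall>e\<in>A. \<alpha> e \<noteq> 0) \<and> (\<forall>x\<in>Z. (\<Sum>e\<in>A. \<alpha> e * (\<Prod>i<d. F i x ^ e i)) = 0))"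

text \<open>
  Products of powers below \<open>N\<close> of the \<open>m\<close> functions give \<open>N\<^sup>m\<close> elements of a space of
  dimension \<open>(m N D + 1)\<^sup>n = O(N\<^sup>n)\<close>.
\<close>

lemma alg_dependent_on_polyfuns:
  fixes F :: "nat \<Rightarrow> ('v \<Rightarrow> 'k::field) \<Rightarrow> 'k"
  assumes "finite I" "card I < m" "\<And>i. i < m \<Longrightarrow> polyfun I (F i)"
  shows "alg_dependent_on UNIV m F"
proof -
  have "\<forall>i. \<exists>D. i < m \<longrightarrow> bounded_polyfun I D (F i)"
    using assms(3) by (auto simp: polyfun_def)
  then obtain D' where D': "\<And>i. i < m \<Longrightarrow> bounded_polyfun I (D' i) (F i)" by metis
  define D where "D = Max (insert 0 (D' ` {..<m}))"
  have D: "bounded_polyfun I D (F i)" if "i < m" for i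
    by (rule bounded_polyfun_mono[OF assms(1) D'[OF that]]) (use that in \<open>auto simp: D_def\<close>)
  define n where "n = card I"
  \<comment> \<open>\<open>N\<close> exceeds \<open>(m * D + 1) ^ n\<close>, so that
    \<open>(N * (m * D + 1)) ^ n < N ^ Suc n \<le> N ^ m\<close>: there are more products than
    monomials.\<close>
  define N where "N = Suc ((m * D + 1) ^ n)"
  define E where "E = {e. (\<forall>i<m. e i < N) \<and> (\<forall>i\<ge>m. e i = (0::nat))}"
  define T where "T = (I \<rightarrow>\<^sub>E {..m * (N * D)})"
  \<comment> \<open>Vectors in \<open>E\<close> are 0 from \<open>m\<close> on, extensional
    functions are \<open>undefined\<close> there; the bijection makes \<open>card_PiE\<close>
    applicable.\<close>
  have bij: "bij_betw (\<lambda>e i. if i < m then e i else 0) ({..<m} \<rightarrow>\<^sub>E {..<N}) E"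
  proof (rule bij_betwI[where g = "\<lambda>e. restrict e {..<m}"])
    show "(\<lambda>e i. if i < m then e i else 0) \<in> ({..<m} \<rightarrow>\<^sub>E {..<N}) \<rightarrow> E"
      by (force simp: E_def PiE_iff)
    show "(\<lambda>e. restrict e {..<m}) \<in> E \<rightarrow> ({..<m} \<rightarrow>\<^sub>E {..<N})"
      by (auto simp: E_def)
  next
    fix e assume "e \<in> {..<m} \<rightarrow>\<^sub>E {..<N}"
    then show "restrict (\<lambda>i. if i < m then e i else 0) {..<m} = e"
      by (auto simp: fun_eq_iff PiE_iff extensional_def)
  next
    fix e assume "e \<in> E"
    then show "(\<lambda>i. if i < m then restrict e {..<m} i else 0) = e"
      by (auto simp: fun_eq_iff E_def)
  qed
  have finE: "finite E"
    using bij_betw_finite[OF bij] by (simp add: finite_PiE)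
  have cardE: "card E = N ^ m"
    using bij_betw_same_card[OF bij] by (simp add: card_PiE)
  have finT: "finite T" and cardT: "card T = (m * (N * D) + 1) ^ n"
    using assms(1) by (simp_all add: T_def finite_PiE card_PiE n_def)
  have "m * (N * D) + 1 \<le> N * (m * D + 1)"
    by (simp add: N_def algebra_simps)
  then have "card T \<le> (N * (m * D + 1)) ^ n"
    unfolding cardT by (rule power_mono) simp
  also have "\<dots> = N ^ n * (m * D + 1) ^ n"
    by (rule power_mult_distrib)
  also have "\<dots> < N ^ n * N"
    by (simp add: N_def)
  also have "\<dots> = N ^ Suc n" by simp
  also have "\<dots> \<le> N ^ m"
    using assms(2) by (intro power_increasing) (auto simp: n_def N_def)
  finally have card: "card T < card E" by (simp add: cardE)
  have "\<exists>c. \<forall>u. (\<Prod>i<m. F i u ^ e i) = (\<Sum>t\<in>T. c t * monomial_fun I t u)" if "e \<in> E" for e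
  proof -
    have "bounded_polyfun I (N * D) (\<lambda>u. F i u ^ e i)" if "i \<in> {..<m}" for i
    proof -
      have "e i * D \<le> N * D" using \<open>e \<in> E\<close> that by (intro mult_right_mono) (auto simp: E_def less_imp_le)
      then show ?thesis
        using that by (intro bounded_polyfun_mono[OF assms(1) bounded_polyfun_power[OF assms(1) D]]) auto
    qed
    from bounded_polyfun_prod[OF assms(1), of "{..<m}" "N * D" "\<lambda>i u. F i u ^ e i", OF this]
    show ?thesis by (simp add: bounded_polyfun_def T_def)
  qed
  then obtain M where M: "\<And>e u. e \<in> E \<Longrightarrow>
      (\<Prod>i<m. F i u ^ e i) = (\<Sum>t\<in>T. M e t * monomial_fun I t u)"
    by metis
  \<comment> \<open>The unknowns are the coefficients of a relation indexed by \<open>E\<close>; the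
    equations say that the coefficient of every monomial in \<open>T\<close> cancels.\<close>
  obtain \<alpha> where \<alpha>: "\<exists>e\<in>E. \<alpha> e \<noteq> 0" "\<forall>t\<in>T. (\<Sum>e\<in>E. \<alpha> e * M e t) = 0"
    using homogeneous_system_solvable[OF finT finE card, of M] by auto
  have zero: "(\<Sum>e\<in>E. \<alpha> e * (\<Prod>i<m. F i u ^ e i)) = 0" for u
  proof -
    have "(\<Sum>e\<in>E. \<alpha> e * (\<Prod>i<m. F i u ^ e i))
        = (\<Sum>e\<in>E. \<Sum>t\<in>T. \<alpha> e * M e t * monomial_fun I t u)"
      by (intro sum.cong) (simp_all add: M sum_distrib_left mult.assoc)
    also have "\<dots> = (\<Sum>t\<in>T. (\<Sum>e\<in>E. \<alpha> e * M e t) * monomial_fun I t u)"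
      by (subst sum.swap) (simp add: sum_distrib_right)
    also have "\<dots> = 0" using \<alpha>(2) by simp
    finally show ?thesis .
  qed
  let ?A = "{e\<in>E. \<alpha> e \<noteq> 0}"
  have "(\<Sum>e\<in>?A. \<alpha> e * (\<Prod>i<m. F i u ^ e i)) = (\<Sum>e\<in>E. \<alpha> e * (\<Prod>i<m. F i u ^ e i))" for u
    using finE by (intro sum.mono_neutral_left) auto
  moreover have "finite ?A" "?A \<noteq> {}" using finE \<alpha>(1) by auto
  moreover have "?A \<subseteq> {e. \<forall>i\<ge>m. e i = 0}" by (auto simp: E_def)
  ultimately show ?thesis
    unfolding alg_dependent_on_def using zero by (intro exI[of _ ?A] exI[of _ \<alpha>]) simp
qed

lemma alg_dependent_on_compose:
  assumes "alg_dependent_on UNIV m (\<lambda>i u. F i (\<phi> u))" "Z \<subseteq> range \<phi>"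
  shows "alg_dependent_on Z m F"
  using assms unfolding alg_dependent_on_def by blast

text \<open>
  Take a relation between \<open>F 0, \<dots>, F d\<close> on \<open>Z'\<close>. By irreducibility a power of \<open>F d\<close> can be
  divided out, so that setting \<open>F d = 0\<close> leaves a nontrivial relation, which holds on \<open>Z\<close>.
\<close>

lemma alg_dependent_on_drop:
  fixes F :: "nat \<Rightarrow> ('v \<Rightarrow> 'k::idom) \<Rightarrow> 'k"
  assumes I: "finite I" and "irreducible_closed I Z'" "Z \<subseteq> Z'"
    and poly: "\<And>i. i \<le> d \<Longrightarrow> polyfun I (F i)"
    and vanish: "\<forall>x\<in>Z. F d x = 0" and nz: "\<exists>x\<in>Z'. F d x \<noteq> 0"
    and dep: "alg_dependent_on Z' (Suc d) F"
  shows "alg_dependent_on Z d F"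
proof -
  obtain A \<alpha> where A: "finite A" "A \<noteq> {}" "A \<subseteq> {e. \<forall>i\<ge>Suc d. e i = 0}" "\<forall>e\<in>A. \<alpha> e \<noteq> 0"
    and rel: "\<And>x. x \<in> Z' \<Longrightarrow> (\<Sum>e\<in>A. \<alpha> e * (\<Prod>i<Suc d. F i x ^ e i)) = 0"
    using dep unfolding alg_dependent_on_def by blast
  \<comment> \<open>The largest power of \<open>F d\<close> that divides every term of the relation;
    \<open>Q\<close> is the quotient.\<close>
  define k where "k = Min ((\<lambda>e. e d) ` A)"
  have k_le: "k \<le> e d" if "e \<in> A" for e
    unfolding k_def using A that by (intro Min_le) auto
  have "k \<in> (\<lambda>e. e d) ` A"
    unfolding k_def using A by (intro Min_in) auto
  then obtain e1 where e1: "e1 \<in> A" "e1 d = k" by auto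
  define Q where "Q x = (\<Sum>e\<in>A. \<alpha> e * ((\<Prod>i<d. F i x ^ e i) * F d x ^ (e d - k)))" for x
  have polyQ: "polyfun I Q"
    unfolding Q_def
    by (intro polyfun_sum polyfun_mult polyfun_const polyfun_prod polyfun_power I poly) auto
  have "F d x ^ k * Q x = 0" if "x \<in> Z'" for x
  proof -
    have "F d x ^ k * Q x = (\<Sum>e\<in>A. \<alpha> e * (\<Prod>i<Suc d. F i x ^ e i))"
      unfolding Q_def sum_distrib_left
    proof (intro sum.cong refl)
      fix e assume "e \<in> A"
      then have "F d x ^ e d = F d x ^ k * F d x ^ (e d - k)"
        using k_le by (simp flip: power_add)
      then show "F d x ^ k * (\<alpha> e * ((\<Prod>i<d. F i x ^ e i) * F d x ^ (e d - k)))
          = \<alpha> e * (\<Prod>i<Suc d. F i x ^ e i)" by simp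
    qed
    then show ?thesis using rel[OF that] by simp
  qed
  then have "(\<forall>x\<in>Z'. F d x ^ k = 0) \<or> (\<forall>x\<in>Z'. Q x = 0)"
    using irreducible_closed_prime[OF I assms(2) polyfun_power[OF I poly[OF order_refl]] polyQ] by blast
  \<comment> \<open>A point of \<open>Z'\<close> at which \<open>F d\<close> is nonzero excludes the
    first alternative.\<close>
  then have Q0: "Q x = 0" if "x \<in> Z'" for x
    using nz that by auto
  \<comment> \<open>Only the terms of \<open>Q\<close> indexed by \<open>A1\<close> survive setting
    \<open>F d = 0\<close>, and \<open>e1\<close> is one of them. \<open>A'\<close> forgets the
    exponent at \<open>d\<close>, which is \<open>k\<close> on all of \<open>A1\<close>; hence no
    two terms merge and the relation stays nontrivial.\<close>
  define A1 where "A1 = {e\<in>A. e d = k}"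
  define A' where "A' = (\<lambda>e. e(d := 0)) ` A1"
  have inj: "inj_on (\<lambda>e. e(d := 0)) A1"
  proof (rule inj_onI, rule ext)
    fix e e' i assume "e \<in> A1" "e' \<in> A1" "e(d := 0) = e'(d := 0)"
    then show "e i = e' i"
      by (cases "i = d") (auto simp: A1_def fun_eq_iff split: if_splits)
  qed
  have "(\<Sum>e\<in>A'. \<alpha> (e(d := k)) * (\<Prod>i<d. F i x ^ e i)) = 0" if "x \<in> Z" for x
  proof -
    have "(\<Sum>e\<in>A'. \<alpha> (e(d := k)) * (\<Prod>i<d. F i x ^ e i))
        = (\<Sum>e\<in>A1. \<alpha> e * (\<Prod>i<d. F i x ^ e i))"
      unfolding A'_def sum.reindex[OF inj]
      by (intro sum.cong) (auto simp: A1_def)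
    also have "\<dots> = (\<Sum>e\<in>A1. \<alpha> e * ((\<Prod>i<d. F i x ^ e i) * F d x ^ (e d - k)))"
      by (intro sum.cong) (auto simp: A1_def)
    also have "\<dots> = Q x"
      unfolding Q_def
    proof (rule sum.mono_neutral_left)
      show "\<forall>e\<in>A - A1. \<alpha> e * ((\<Prod>i<d. F i x ^ e i) * F d x ^ (e d - k)) = 0"
      proof
        fix e assume "e \<in> A - A1"
        then have "e d - k \<noteq> 0" using k_le[of e] by (auto simp: A1_def)
        then show "\<alpha> e * ((\<Prod>i<d. F i x ^ e i) * F d x ^ (e d - k)) = 0"
          using vanish that by (simp add: power_0_left)
      qed
    qed (use A in \<open>auto simp: A1_def\<close>)
    also have "\<dots> = 0" using Q0 that assms(3) by auto
    finally show ?thesis .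
  qed
  moreover have "finite A'" "A' \<noteq> {}" using A(1) e1 by (auto simp: A'_def A1_def)
  moreover have "A' \<subseteq> {e. \<forall>i\<ge>d. e i = 0}"
  proof
    fix e' assume "e' \<in> A'"
    then obtain e where e: "e \<in> A" "e' = e(d := 0)" by (auto simp: A'_def A1_def)
    then have "\<forall>i\<ge>Suc d. e i = 0" using A(3) by blast
    then show "e' \<in> {e. \<forall>i\<ge>d. e i = 0}" using e(2) by (auto simp: Suc_le_eq)
  qed
  moreover have "\<forall>e\<in>A'. \<alpha> (e(d := k)) \<noteq> 0"
  proof
    fix e' assume "e' \<in> A'"
    then obtain e where "e \<in> A" "e d = k" "e' = e(d := 0)" by (auto simp: A'_def A1_def)
    then show "\<alpha> (e'(d := k)) \<noteq> 0" using A(4) by auto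
  qed
  ultimately show ?thesis
    unfolding alg_dependent_on_def
    by (intro exI[of _ A'] exI[of _ "\<lambda>e. \<alpha> (e(d := k))"]) simp
qed

text \<open>Induction along the chain: \<open>alg_dependent_on_drop\<close>, read contrapositively,
  shows that a polynomial vanishing on \<open>Z m\<close> but not on \<open>Z (Suc m)\<close>
  extends an independent family by one member.\<close>

lemma chain_alg_independent:
  fixes Z :: "nat \<Rightarrow> ('v \<Rightarrow> 'k::idom) set"
  assumes I: "finite I"
    and irr: "\<And>i. i \<le> m \<Longrightarrow> irreducible_closed I (Z i)"
    and strict: "\<And>i. i < m \<Longrightarrow> Z i \<subset> Z (Suc i)"
  shows "\<exists>F. (\<forall>i<m. polyfun I (F i)) \<and> \<not> alg_dependent_on (Z m) m F"
  using irr strict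
proof (induction m)
  case 0
  then obtain x where x: "x \<in> Z 0" by (fastforce simp: irreducible_closed_def)
  have "\<not> alg_dependent_on (Z 0) 0 F" for F :: "nat \<Rightarrow> ('v \<Rightarrow> 'k) \<Rightarrow> 'k"
  proof
    assume "alg_dependent_on (Z 0) 0 F"
    then obtain A :: "(nat \<Rightarrow> nat) set" and \<alpha> where A: "finite A" "A \<noteq> {}" "A \<subseteq> {e. \<forall>i\<ge>0. e i = 0}"
      "\<forall>e\<in>A. \<alpha> e \<noteq> 0" "\<forall>x\<in>Z 0. (\<Sum>e\<in>A. \<alpha> e * (\<Prod>i<0. F i x ^ e i)) = 0"
      unfolding alg_dependent_on_def by (elim exE conjE) (rule that)
    \<comment> \<open>The only admissible exponent vector is 0, so the relation would be a nonzero
      constant vanishing at \<open>x\<close>.\<close>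
    have "A \<subseteq> {\<lambda>_. 0}" using A(3) by auto
    then have "A = {\<lambda>_. 0}" using A(2) by (simp add: subset_singleton_iff)
    then show False using A(4,5) x by auto
  qed
  then show ?case by auto
next
  case (Suc m)
  have "\<exists>F. (\<forall>i<m. polyfun I (F i)) \<and> \<not> alg_dependent_on (Z m) m F"
    by (rule Suc.IH) (use Suc.prems in auto)
  then obtain F where F: "\<And>i. i < m \<Longrightarrow> polyfun I (F i)" "\<not> alg_dependent_on (Z m) m F"
    by auto
  have less: "Z m \<subset> Z (Suc m)" and irr: "irreducible_closed I (Z m)" "irreducible_closed I (Z (Suc m))"
    using Suc.prems by auto
  obtain S where S: "S \<subseteq> poly_ring I" "Z m = zero_locus I S"
    using irr(1) by (auto simp: irreducible_closed_def zariski_closed_def)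
  obtain x where x: "x \<in> Z (Suc m)" "x \<notin> Z m" using less by blast
  \<comment> \<open>Since \<open>x\<close> is a point of affine space, it can miss
    \<open>Z m\<close> only by violating an equation.\<close>
  then have "x \<in> affine_space I"
    using irr(2) by (auto simp: irreducible_closed_def zariski_closed_def zero_locus_def)
  then obtain f where f: "f \<in> S" "mpoly_eval x f \<noteq> 0"
    using x(2) unfolding S(2) zero_locus_def by blast
  define G where "G = F(m := \<lambda>x. mpoly_eval x f)"
  have G: "polyfun I (G i)" if "i \<le> m" for i
    using F(1)[of i] that polyfun_mpoly_eval[OF I, of f] f(1) S(1) by (auto simp: G_def)
  have "\<not> alg_dependent_on (Z m) m G"
  proof -
    have "(\<Prod>i<m. G i x ^ e i) = (\<Prod>i<m. F i x ^ e i)" for x and e :: "nat \<Rightarrow> nat"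
      by (intro prod.cong) (auto simp: G_def)
    then show ?thesis using F(2) by (simp add: alg_dependent_on_def)
  qed
  moreover have "alg_dependent_on (Z m) m G" if "alg_dependent_on (Z (Suc m)) (Suc m) G"
    by (rule alg_dependent_on_drop[OF I irr(2) _ G _ _ that])
       (use less f x(1) in \<open>auto simp: G_def S(2) zero_locus_def\<close>)
  ultimately show ?case using G by (intro exI[of _ G]) auto
qed

text \<open>Bounds the dimension of an image by the number of parameters. Functions that are
  independent on \<open>Z m\<close> stay independent when pulled back along \<open>\<phi>\<close>,
  because \<open>Z m\<close> lies in the range, and more than \<open>card I\<close> polynomial
  functions are always dependent.\<close>

lemma chain_length_le:
  fixes Z :: "nat \<Rightarrow> ('v \<Rightarrow> 'k::field) set" and \<phi> :: "('w \<Rightarrow> 'k) \<Rightarrow> 'v \<Rightarrow> 'k"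
  assumes "finite I" "finite J" "\<And>j. j \<in> J \<Longrightarrow> polyfun I (\<lambda>u. \<phi> u j)"
    and "\<And>i. i \<le> m \<Longrightarrow> irreducible_closed J (Z i)" "\<And>i. i < m \<Longrightarrow> Z i \<subset> Z (Suc i)"
    and "Z m \<subseteq> range \<phi>"
  shows "m \<le> card I"
proof (rule ccontr)
  assume "\<not> m \<le> card I"
  have "\<exists>F. (\<forall>i<m. polyfun J (F i)) \<and> \<not> alg_dependent_on (Z m) m F"
    by (rule chain_alg_independent[OF assms(2)]) (fact assms(4), fact assms(5))
  then obtain F where F: "\<And>i. i < m \<Longrightarrow> polyfun J (F i)" "\<not> alg_dependent_on (Z m) m F"
    by auto
  have "alg_dependent_on UNIV m (\<lambda>i u. F i (\<phi> u))"
  proof (rule alg_dependent_on_polyfuns[OF assms(1)])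
    show "polyfun I (\<lambda>u. F i (\<phi> u))" if "i < m" for i
      by (rule polyfun_compose[OF assms(1,2) F(1)[OF that]]) (rule assms(3))
  qed (use \<open>\<not> m \<le> card I\<close> in simp)
  from alg_dependent_on_compose[OF this assms(6)] show False using F(2) by simp
qed

section \<open>Irreducibility of images of convex sets\<close>

text \<open>Reduces irreducibility to one variable: each coordinate is replaced by the polynomial
  \<open>[:x i, y i - x i:]\<close> in \<open>t\<close>.\<close>

lemma polyfun_on_line:
  fixes f :: "('v \<Rightarrow> 'k::comm_ring_1) \<Rightarrow> 'k"
  assumes "polyfun I f"
  shows "\<exists>q. \<forall>t. f (\<lambda>i. x i + t * (y i - x i)) = poly q t"
proof -
  obtain D c where c: "\<And>u. f u = (\<Sum>e \<in> I \<rightarrow>\<^sub>E {..D}. c e * monomial_fun I e u)"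
    using assms unfolding polyfun_def bounded_polyfun_def by blast
  show ?thesis
    by (intro exI[of _ "\<Sum>e \<in> I \<rightarrow>\<^sub>E {..D}. smult (c e) (\<Prod>i\<in>I. [:x i, y i - x i:] ^ e i)"])
       (simp add: c monomial_fun_def poly_sum poly_prod)
qed

text \<open>If \<open>q * r\<close> vanishes everywhere, then \<open>q * r + 1\<close> has no root,
  hence is constant. So \<open>q * r\<close> is constant too, and its value at 0 shows that it is
  zero.\<close>

lemma poly_mult_vanishing:
  fixes q r :: "'k::alg_closed_field poly"
  assumes "\<And>t. poly q t * poly r t = 0"
  shows "q = 0 \<or> r = 0"
proof (rule ccontr)
  assume "\<not> (q = 0 \<or> r = 0)"
  then have "q * r \<noteq> 0" by simp
  have vanish: "poly (q * r) t = 0" for t using assms by simp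
  have "\<not> degree (q * r + 1) > 0"
  proof
    assume "degree (q * r + 1) > 0"
    then obtain t where "poly (q * r + 1) t = 0" using alg_closed_imp_poly_has_root by blast
    then show False using vanish[of t] by (simp only: poly_add poly_1) simp
  qed
  then obtain a where a: "q * r + 1 = [:a:]" by (auto elim: degree_eq_zeroE)
  then have "q * r = [:a - 1:]" 
    by (metis add_diff_cancel_right' diff_pCons minus_pCons one_pCons diff_zero)
  then show False using \<open>q * r \<noteq> 0\<close> vanish[of 0] by simp
qed

text \<open>Suppose that closed sets \<open>A\<close> and \<open>B\<close> cover the image and
  neither is all of it. Choose \<open>x\<close> mapping outside \<open>A\<close> and
  \<open>y\<close> mapping outside \<open>B\<close>. On the line through \<open>x\<close> and
  \<open>y\<close>, an equation of \<open>A\<close> and one of \<open>B\<close> become univariate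
  polynomials that are both nonzero, yet their product vanishes everywhere.\<close>

lemma irreducible_closed_image:
  fixes \<phi> :: "('w \<Rightarrow> 'k::alg_closed_field) \<Rightarrow> 'v \<Rightarrow> 'k"
  assumes I: "finite I" and J: "finite J" and \<phi>: "\<And>j. j \<in> J \<Longrightarrow> polyfun I (\<lambda>u. \<phi> u j)"
    and closed: "zariski_closed J (\<phi> ` L)" and ne: "L \<noteq> {}"
    and lines: "\<And>x y t. x \<in> L \<Longrightarrow> y \<in> L \<Longrightarrow> \<phi> (\<lambda>i. x i + t * (y i - x i)) \<in> \<phi> ` L"
  shows "irreducible_closed J (\<phi> ` L)"
  unfolding irreducible_closed_def
proof (intro conjI allI impI)
  fix A B assume A: "zariski_closed J A" and B: "zariski_closed J B" and AB: "\<phi> ` L = A \<union> B"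
  show "A = \<phi> ` L \<or> B = \<phi> ` L"
  proof (rule ccontr)
    assume "\<not> (A = \<phi> ` L \<or> B = \<phi> ` L)"
    then obtain x y where xy: "x \<in> L" "\<phi> x \<notin> A" "y \<in> L" "\<phi> y \<notin> B" using AB by blast
    \<comment> \<open>A point of affine space outside a closed set violates one of its equations;
      \<open>closed\<close> ensures that the image lies in affine space.\<close>
    have sep: "\<exists>f. polyfun J f \<and> (\<forall>z\<in>C. f z = 0) \<and> f w \<noteq> 0"
      if C: "zariski_closed J C" and w: "w \<notin> C" "w \<in> \<phi> ` L" for C w
    proof -
      obtain S where S: "S \<subseteq> poly_ring J" "C = zero_locus J S"
        using C by (auto simp: zariski_closed_def)
      moreover have "w \<in> affine_space J"
        using closed w(2) by (auto simp: zariski_closed_def zero_locus_def)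
      ultimately obtain f where "f \<in> S" "mpoly_eval w f \<noteq> 0"
        using w(1) unfolding S(2) zero_locus_def by blast
      then show ?thesis
        using S polyfun_mpoly_eval[OF J] by (intro exI[of _ "\<lambda>x. mpoly_eval x f"]) (auto simp: zero_locus_def)
    qed
    obtain f where f: "polyfun J f" "\<forall>z\<in>A. f z = 0" "f (\<phi> x) \<noteq> 0" using sep[OF A] xy by blast
    obtain g where g: "polyfun J g" "\<forall>z\<in>B. g z = 0" "g (\<phi> y) \<noteq> 0" using sep[OF B] xy by blast
    have compose: "polyfun I (\<lambda>u. h (\<phi> u))" if "polyfun J h" for h
      by (rule polyfun_compose[OF I J that]) (rule \<phi>)
    obtain q where q: "\<And>t. f (\<phi> (\<lambda>i. x i + t * (y i - x i))) = poly q t"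
      using polyfun_on_line[OF compose[OF f(1)], where x = x and y = y] by auto
    obtain r where r: "\<And>t. g (\<phi> (\<lambda>i. x i + t * (y i - x i))) = poly r t"
      using polyfun_on_line[OF compose[OF g(1)], where x = x and y = y] by auto
    have "poly q t * poly r t = 0" for t
      using lines[OF xy(1,3), of t] f(2) g(2) AB unfolding q[symmetric] r[symmetric] by auto
    then have "q = 0 \<or> r = 0" by (rule poly_mult_vanishing)
    \<comment> \<open>The line passes through \<open>x\<close> at \<open>t = 0\<close> and through
      \<open>y\<close> at \<open>t = 1\<close>.\<close>
    then show False using q[of 0] r[of 1] f(3) g(3) by auto
  qed
qed (use closed ne in auto)

section \<open>Binomials cutting out the toric variety\<close>

text \<open>Additivity of the Frobenius on \<open>x = (x - y) + y\<close> gives that the power of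
  \<open>x - y\<close> is 0, and a domain has no nonzero nilpotents.\<close>

lemma frobenius_power_inj:
  fixes x y :: "'k::idom"
  assumes "prime CHAR('k)" "x ^ (CHAR('k) ^ l) = y ^ (CHAR('k) ^ l)"
  shows "x = y"
proof -
  have "x ^ (CHAR('k) ^ l) = (x - y) ^ (CHAR('k) ^ l) + y ^ (CHAR('k) ^ l)"
    using freshmans_dream'[OF assms(1) refl, of "x - y" y l] by simp
  then show ?thesis using assms(2) by simp
qed

text \<open>With the Bezout relation \<open>a * i = d * j + 1\<close> the common root is
  \<open>s = x ^ i / y ^ j\<close>; if \<open>y = 0\<close>, then \<open>x = 0\<close> and
  \<open>s = 0\<close> serves.\<close>

lemma coprime_powers_common_root:
  fixes x y :: "'k::field"
  assumes "a > 0" "d > 0" "coprime a d" "x ^ d = y ^ a"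
  obtains s where "x = s ^ a" "y = s ^ d"
proof (cases "y = 0")
  case True
  then show ?thesis using assms that[of 0] by (simp add: power_0_left)
next
  case False
  then have "x \<noteq> 0" using assms by (auto simp: power_0_left)
  obtain i j where ij: "a * i = d * j + 1"
    using bezout_nat[of a d] assms by auto
  have "(x ^ i / y ^ j) ^ a = x ^ (a * i) / (y ^ a) ^ j"
    by (simp add: power_divide mult.commute flip: power_mult)
  also have "x ^ (a * i) = x ^ (d * j + 1)" by (simp only: ij)
  also have "(y ^ a) ^ j = x ^ (d * j)" by (simp add: assms(4)[symmetric] power_mult)
  finally have 1: "x = (x ^ i / y ^ j) ^ a" using \<open>x \<noteq> 0\<close> by simp
  have "(x ^ i / y ^ j) ^ d = (x ^ d) ^ i / y ^ (d * j)"
    by (simp add: power_divide mult.commute flip: power_mult)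
  also have "(x ^ d) ^ i = y ^ (d * j + 1)" by (simp only: assms(4) power_mult[symmetric] ij)
  finally have "y = (x ^ i / y ^ j) ^ d" using False by simp
  with 1 show ?thesis by (rule that)
qed

section \<open>The binomials as formal polynomials\<close>

definition toric_lhs :: "nat \<Rightarrow> nat \<Rightarrow> nat \<Rightarrow> nat \<Rightarrow> coord \<Rightarrow>\<^sub>0 nat" where
  "toric_lhs n q a i = Poly_Mapping.single (Y i) (if i = n - 1 then a else q)"

definition toric_rhs ::
    "nat \<Rightarrow> nat \<Rightarrow> nat \<Rightarrow> (nat \<Rightarrow> nat) \<Rightarrow> (nat \<Rightarrow> nat) \<Rightarrow> nat \<Rightarrow> nat \<Rightarrow> nat \<Rightarrow> coord \<Rightarrow>\<^sub>0 nat" where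
  "toric_rhs n q d b c g h i =
     (if i \<le> n - 2 then Poly_Mapping.single (X i) (b i * q) + Poly_Mapping.single (X (n - 1)) (c i)
      else if i = n - 1 then Poly_Mapping.single (X n) d
      else Poly_Mapping.single (X (n - 1)) 1 + Poly_Mapping.single (X n) g
           + Poly_Mapping.single (Y (n - 1)) h)"

definition toric_binomial ::
    "nat \<Rightarrow> nat \<Rightarrow> nat \<Rightarrow> nat \<Rightarrow> (nat \<Rightarrow> nat) \<Rightarrow> (nat \<Rightarrow> nat) \<Rightarrow> nat \<Rightarrow> nat \<Rightarrow> nat \<Rightarrow>
     (coord, 'k::comm_ring_1) mpoly" where
  "toric_binomial n q a d b c g h i =
     Poly_Mapping.single (toric_lhs n q a i) 1 - Poly_Mapping.single (toric_rhs n q d b c g h i) 1"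

lemma mpoly_eval_toric_binomial:
  "mpoly_eval x (toric_binomial n q a d b c g h i) =
     x (Y i) ^ (if i = n - 1 then a else q) -
     (if i \<le> n - 2 then x (X i) ^ (b i * q) * x (X (n - 1)) ^ c i
      else if i = n - 1 then x (X n) ^ d
      else x (X (n - 1)) * x (X n) ^ g * x (Y (n - 1)) ^ h)"
  by (simp add: toric_binomial_def toric_lhs_def toric_rhs_def mpoly_eval_minus
      mpoly_eval_single_add mpoly_eval_single_single)

lemma finite_coords [simp]: "finite (coords n)"
  by (simp add: coords_def)

lemma card_coords: "card (coords n) = 2 * n"
proof -
  have "inj_on X {1..n}" "inj_on Y {1..n}" by (auto simp: inj_on_def)
  moreover have "X ` {1..n} \<inter> Y ` {1..n} = {}" by auto
  ultimately show ?thesis by (simp add: coords_def card_Un_disjoint card_image)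
qed

text \<open>At the unit vector of \<open>Y i\<close> every right-hand monomial vanishes, since it
  contains a positive power of \<open>X (n - 1)\<close> or \<open>X n\<close>. These values show
  both that each binomial is nonzero and that the \<open>n\<close> binomials are distinct, without
  comparing exponent vectors.\<close>

lemma toric_binomial_unit_point:
  assumes "n \<ge> 3" "q > 0" "a > 0" "d > 0" "h > 0" "\<forall>i \<in> {1..n - 2}. c i > 0"
    and "i \<in> {1..n}" "j \<in> {1..n}"
  shows "mpoly_eval (\<lambda>v. of_bool (v = Y i)) (toric_binomial n q a d b c g h j) =
           (of_bool (i = j) :: 'k::comm_ring_1)"
proof -
  consider "j \<le> n - 2" "j \<noteq> n - 1" "c j \<noteq> 0" | "\<not> j \<le> n - 2" "j = n - 1" | "\<not> j \<le> n - 2" "j \<noteq> n - 1"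
    using assms by force
  then show ?thesis
    by cases (use assms(2-5) in \<open>auto simp: mpoly_eval_toric_binomial power_0_left\<close>)
qed

lemma toric_binomial_in_binomials:
  assumes "n \<ge> 3" "q > 0" "a > 0" "d > 0" "h > 0" "\<forall>i \<in> {1..n - 2}. c i > 0" "i \<in> {1..n}"
  shows "(toric_binomial n q a d b c g h i :: (coord, 'k::comm_ring_1) mpoly) \<in> binomials (coords n)"
proof -
  have "Poly_Mapping.keys (toric_lhs n q a i) \<subseteq> coords n"
    using assms by (auto simp: toric_lhs_def coords_def)
  moreover have "Poly_Mapping.keys (toric_rhs n q d b c g h i) \<subseteq> coords n"
    unfolding toric_rhs_def using assms
    by (auto simp: coords_def split: if_splits dest!: subsetD[OF keys_add])
  moreover have "(toric_binomial n q a d b c g h i :: (coord, 'k) mpoly) \<noteq> 0"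
  proof
    assume *: "(toric_binomial n q a d b c g h i :: (coord, 'k) mpoly) = 0"
    show False
      using toric_binomial_unit_point[OF assms(1-6) assms(7,7), where 'k = 'k and b = b and g = g]
      unfolding * by (simp add: mpoly_eval_def)
  qed
  then have "(Poly_Mapping.single (toric_lhs n q a i) 1 :: (coord, 'k) mpoly)
      \<noteq> Poly_Mapping.single (toric_rhs n q d b c g h i) 1"
    by (simp add: toric_binomial_def)
  ultimately show ?thesis
    unfolding binomials_def monomials_def toric_binomial_def by blast
qed

lemma card_toric_binomials:
  assumes "n \<ge> 3" "q > 0" "a > 0" "d > 0" "h > 0" "\<forall>i \<in> {1..n - 2}. c i > 0"
  shows "card ((toric_binomial n q a d b c g h :: _ \<Rightarrow> (coord, 'k::comm_ring_1) mpoly) ` {1..n}) = n"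
proof -
  have "inj_on (toric_binomial n q a d b c g h :: _ \<Rightarrow> (coord, 'k) mpoly) {1..n}"
  proof (rule inj_onI)
    fix i j assume ij: "i \<in> {1..n}" "j \<in> {1..n}"
      "(toric_binomial n q a d b c g h i :: (coord, 'k) mpoly) = toric_binomial n q a d b c g h j"
    then show "i = j"
      using toric_binomial_unit_point[OF assms ij(1) ij(1), where 'k = 'k and b = b and g = g]
        toric_binomial_unit_point[OF assms ij(1) ij(2), where 'k = 'k and b = b and g = g]
      by (auto split: if_splits)
  qed
  then show ?thesis by (simp add: card_image)
qed

lemma toric_variety_eq_range:
  assumes "n \<ge> 3"
  shows "toric_variety n p l a d b c = range (toric_point n p l a d b c)"
proof -
  have "toric_point n p l a d b c u \<in> toric_point n p l a d b c ` affine_space {1..n}"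
    for u :: "nat \<Rightarrow> 'a"
  proof (rule image_eqI)
    show "toric_point n p l a d b c u = toric_point n p l a d b c (restrict u {1..n})"
      unfolding toric_point_def using assms by (auto simp: fun_eq_iff coords_def)
    show "restrict u {1..n} \<in> affine_space {1..n}"
      by (simp add: affine_space_def)
  qed
  then show ?thesis unfolding toric_variety_def by blast
qed

lemma polyfun_toric_point:
  assumes "n \<ge> 3" "v \<in> coords n"
  shows "polyfun {1..n} (\<lambda>u :: nat \<Rightarrow> 'k::comm_ring_1. toric_point n p l a d b c u v)"
proof -
  have coord: "polyfun {1..n} (\<lambda>u :: nat \<Rightarrow> 'k. u i ^ k)" if "i \<in> {1..n}" for i k
    using that by (intro polyfun_power polyfun_coordinate) auto
  show ?thesis
  proof (cases v)
    case (X i)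
    then have "i \<in> {1..n}" using assms by (auto simp: coords_def)
    then have "polyfun {1..n} (\<lambda>u :: nat \<Rightarrow> 'k. u i)"
      "polyfun {1..n} (\<lambda>u :: nat \<Rightarrow> 'k. u (n - 1) ^ (p ^ l))"
      "polyfun {1..n} (\<lambda>u :: nat \<Rightarrow> 'k. u n ^ a)"
      using assms(1) by (auto intro!: polyfun_coordinate coord simp del: One_nat_def)
    then show ?thesis
      using assms(2) X by (cases "i \<le> n - 2"; cases "i = n - 1") (simp_all add: toric_point_def)
  next
    case (Y i)
    then have i: "i \<in> {1..n}" using assms by (auto simp: coords_def)
    have "polyfun {1..n} (\<lambda>u :: nat \<Rightarrow> 'k. u i ^ b i * u (n - 1) ^ c i)"
      "polyfun {1..n} (\<lambda>u :: nat \<Rightarrow> 'k. u (n - 1) * u n)"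
      "polyfun {1..n} (\<lambda>u :: nat \<Rightarrow> 'k. u n ^ d)"
      using assms(1) i by (auto intro!: polyfun_mult polyfun_coordinate coord simp del: One_nat_def)
    then show ?thesis
      using assms(2) Y by (cases "i \<le> n - 2"; cases "i = n - 1") (simp_all add: toric_point_def)
  qed
qed

lemma zero_locus_toric_binomials:
  fixes b c :: "nat \<Rightarrow> nat"
  assumes "n \<ge> 3" "prime p" "CHAR('k::alg_closed_field) = p" "a > 0" "d > 0" "coprime a d"
    and gh: "p ^ l = a * g + d * h"
  shows "zero_locus (coords n) (toric_binomial n (p ^ l) a d b c g h ` {1..n}) =
           (toric_variety n p l a d b c :: (coord \<Rightarrow> 'k) set)" (is "?L = ?V")
proof -
  have ineqs: "n - 1 \<noteq> n" "\<not> n \<le> n - 2" "\<not> n - 1 \<le> n - 2" using assms(1) by auto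
  show ?thesis
  proof (intro equalityI subsetI)
    fix x :: "coord \<Rightarrow> 'k" assume "x \<in> ?V"
    then obtain u where u: "x = toric_point n p l a d b c u"
      by (auto simp: toric_variety_eq_range[OF assms(1)])
    have "mpoly_eval x (toric_binomial n (p ^ l) a d b c g h i) = 0" if i: "i \<in> {1..n}" for i
    proof -
      consider "i \<le> n - 2" | "i = n - 1" | "i = n" using i by force
      then show ?thesis
      proof cases
        case 1
        then show ?thesis using assms(1) i ineqs
          by (simp add: mpoly_eval_toric_binomial u toric_point_def coords_def
              power_mult_distrib flip: power_mult) (simp add: mult.commute)
      next
        case 2
        then show ?thesis using assms(1) ineqs
          by (simp add: mpoly_eval_toric_binomial u toric_point_def coords_def mult.commute
              flip: power_mult)
      next
        \<comment> \<open>Here \<open>p ^ l = a * g + d * h\<close> splits the power of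
          \<open>u n\<close> into \<open>(u n ^ a) ^ g\<close> and
          \<open>(u n ^ d) ^ h\<close>.\<close>
        case 3
        then show ?thesis using assms(1) ineqs
          by (simp add: mpoly_eval_toric_binomial u toric_point_def coords_def
              power_mult_distrib gh power_add flip: power_mult)
      qed
    qed
    moreover have "x \<in> affine_space (coords n)"
      by (simp add: u toric_point_def affine_space_def)
    ultimately show "x \<in> ?L" by (auto simp: zero_locus_def)
  next
    fix x :: "coord \<Rightarrow> 'k" assume x: "x \<in> ?L"
    then have ext: "x v = undefined" if "v \<notin> coords n" for v
      using that by (auto simp: zero_locus_def affine_space_def)
    have eval: "mpoly_eval x (toric_binomial n (p ^ l) a d b c g h i) = 0" if "i \<in> {1..n}" for i
      using x that by (auto simp: zero_locus_def)
    have inj: "y = z" if "y ^ (p ^ l) = z ^ (p ^ l)" for y z :: 'k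
      using frobenius_power_inj[of y l z] that assms(2,3) by simp
    have "p ^ l > 0" using assms(2) prime_gt_0_nat by simp
    \<comment> \<open>By \<open>inj\<close> this root is unique, so the one \<open>w\<close> fits
      all the equations for \<open>Y i\<close> and for \<open>Y n\<close>; no choice of roots of
      unity has to be matched.\<close>
    then obtain w where w: "w ^ (p ^ l) = x (X (n - 1))"
      using nth_root_exists by metis
    have "x (X n) ^ d = x (Y (n - 1)) ^ a"
      using eval[of "n - 1"] assms(1) ineqs by (simp add: mpoly_eval_toric_binomial)
    then obtain s where s: "x (X n) = s ^ a" "x (Y (n - 1)) = s ^ d"
      using coprime_powers_common_root assms(4-6) by metis
    define u where "u i = (if i = n - 1 then w else if i = n then s else x (X i))" for i
    have Y_small: "x (Y i) = u i ^ b i * w ^ c i" if "i \<in> {1..n - 2}" for i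
    proof (rule inj)
      have i: "i \<in> {1..n}" "i \<le> n - 2" "i \<noteq> n - 1" using that assms(1) by auto
      have "x (Y i) ^ (p ^ l) = x (X i) ^ (b i * p ^ l) * x (X (n - 1)) ^ c i"
        using eval[OF i(1)] i(2,3) by (simp add: mpoly_eval_toric_binomial)
      also have "\<dots> = (u i ^ b i * w ^ c i) ^ (p ^ l)"
        using that assms(1) unfolding w[symmetric]
        by (auto simp: u_def power_mult_distrib mult.commute simp flip: power_mult)
      finally show "x (Y i) ^ (p ^ l) = (u i ^ b i * w ^ c i) ^ (p ^ l)" .
    qed
    have Y_last: "x (Y n) = w * s"
    proof (rule inj)
      have "x (Y n) ^ (p ^ l) = x (X (n - 1)) * x (X n) ^ g * x (Y (n - 1)) ^ h"
        using eval[of n] assms(1) ineqs by (simp add: mpoly_eval_toric_binomial)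
      also have "\<dots> = (w * s) ^ (p ^ l)"
        unfolding s w[symmetric] power_mult_distrib
        by (simp add: gh power_add flip: power_mult)
      finally show "x (Y n) ^ (p ^ l) = (w * s) ^ (p ^ l)" .
    qed
    have "x = toric_point n p l a d b c u"
    proof
      fix v
      show "x v = toric_point n p l a d b c u v"
      proof (cases "v \<in> coords n")
        case False
        then show ?thesis by (simp add: ext toric_point_def)
      next
        case True
        show ?thesis
        proof (cases v)
          case (X i)
          then have "i \<in> {1..n}" using True by (auto simp: coords_def)
          then consider "i \<le> n - 2" "i \<ge> 1" | "i = n - 1" | "i = n" by force
          then show ?thesis
            by cases (use X True assms(1) w s in \<open>auto simp: toric_point_def u_def\<close>)
        next
          case (Y i)
          then have "i \<in> {1..n}" using True by (auto simp: coords_def)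
          then consider "i \<le> n - 2" "i \<ge> 1" | "i = n - 1" | "i = n" by force
          then show ?thesis
            by cases (use Y True assms(1) s Y_small Y_last in \<open>auto simp: toric_point_def u_def\<close>)
        qed
      qed
    qed
    then show "x \<in> ?V" by (simp add: toric_variety_eq_range[OF assms(1)])
  qed
qed

section \<open>Dimension of the toric variety\<close>

text \<open>Each coordinate \<open>X i\<close> is a positive power of \<open>u i\<close>. Vanishing
  of parameters can therefore be read off in the image, which makes images of coordinate subspaces
  closed and keeps their inclusions strict.\<close>

lemma toric_point_X_eq_0_iff:
  fixes u :: "nat \<Rightarrow> 'k::idom"
  assumes "a > 0" "p > 0" "i \<in> {1..n}"
  shows "toric_point n p l a d b c u (X i) = 0 \<longleftrightarrow> u i = 0"
proof -
  consider "i \<le> n - 2" | "i > n - 2" "i = n - 1" | "i > n - 2" "i \<noteq> n - 1" "i = n"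
    using assms(3) by force
  then show ?thesis
    using assms by cases (auto simp: toric_point_def coords_def)
qed

lemma variety_dim_toric_variety:
  assumes n: "n \<ge> 3" and p: "p > 0" and a: "a > 0"
    and closed: "zariski_closed (coords n) (toric_variety n p l a d b c :: (coord \<Rightarrow> 'k::alg_closed_field) set)"
  shows "variety_dim (coords n) (toric_variety n p l a d b c :: (coord \<Rightarrow> 'k) set) = enat n"
    (is "variety_dim _ ?V = _")
proof -
  let ?\<phi> = "toric_point n p l a d b c :: (nat \<Rightarrow> 'k) \<Rightarrow> coord \<Rightarrow> 'k"
  have V: "?V = range ?\<phi>" by (rule toric_variety_eq_range[OF n])
  \<comment> \<open>Coordinate subspaces: among the entries \<open>1..n\<close> only the first
    \<open>k\<close> may be nonzero. Other indices are unconstrained, as the parametrization ignores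
    them.\<close>
  define L :: "nat \<Rightarrow> (nat \<Rightarrow> 'k) set" where "L k = {u. \<forall>i\<in>{k<..n}. u i = 0}" for k
  obtain S where S: "S \<subseteq> poly_ring (coords n)" "?V = zero_locus (coords n) S"
    using closed by (auto simp: zariski_closed_def)
  \<comment> \<open>The indeterminates \<open>X i\<close> with \<open>i > k\<close>, added to
    equations of \<open>?V\<close>, cut out the image of \<open>L k\<close>.\<close>
  define x :: "nat \<Rightarrow> (coord, 'k) mpoly"
    where "x i = Poly_Mapping.single (Poly_Mapping.single (X i) 1) 1" for i
  have closed_L: "zariski_closed (coords n) (?\<phi> ` L k)" for k
  proof -
    have "?\<phi> ` L k = zero_locus (coords n) (S \<union> x ` {k<..n})" (is "_ = ?R")
    proof (intro equalityI subsetI)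
      fix z assume "z \<in> ?\<phi> ` L k"
      then obtain u where u: "u \<in> L k" "z = ?\<phi> u" by blast
      then have "z \<in> zero_locus (coords n) S" using V S(2) by auto
      moreover have "mpoly_eval z (x i) = 0" if "i \<in> {k<..n}" for i
        using toric_point_X_eq_0_iff[OF a p, of i n l d b c u] u that
        by (simp add: x_def mpoly_eval_single_single L_def)
      ultimately show "z \<in> ?R" by (auto simp: zero_locus_def)
    next
      fix z assume z: "z \<in> ?R"
      then have "z \<in> ?V" unfolding S(2) by (auto simp: zero_locus_def)
      then obtain u where u: "z = ?\<phi> u" using V by auto
      have "u i = 0" if "i \<in> {k<..n}" for i
      proof -
        have "mpoly_eval z (x i) = 0" using z that by (auto simp: zero_locus_def)
        then show ?thesis
          using toric_point_X_eq_0_iff[OF a p, of i n l d b c u] u that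
          by (simp add: x_def mpoly_eval_single_single)
      qed
      then show "z \<in> ?\<phi> ` L k" using u by (auto simp: L_def)
    qed
    moreover have "x ` {k<..n} \<subseteq> poly_ring (coords n)"
      by (auto simp: x_def poly_ring_def coords_def)
    ultimately show ?thesis using S(1) by (simp add: zariski_closed_zero_locus)
  qed
  have irr: "irreducible_closed (coords n) (?\<phi> ` L k)" for k
  proof (rule irreducible_closed_image[OF _ _ _ closed_L])
    show "polyfun {1..n} (\<lambda>u. ?\<phi> u j)" if "j \<in> coords n" for j
      by (rule polyfun_toric_point[OF n that])
    have "(\<lambda>_. 0) \<in> L k" by (simp add: L_def)
    then show "L k \<noteq> {}" by blast
    show "?\<phi> (\<lambda>i. u i + t * (w i - u i)) \<in> ?\<phi> ` L k" if "u \<in> L k" "w \<in> L k" for u w t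
      using that by (intro imageI) (simp add: L_def)
  qed simp_all
  have strict: "?\<phi> ` L k \<subset> ?\<phi> ` L (Suc k)" if "k < n" for k
  proof
    show "?\<phi> ` L k \<subseteq> ?\<phi> ` L (Suc k)" by (intro image_mono) (auto simp: L_def)
    \<comment> \<open>The unit vector in direction \<open>Suc k\<close>: its image has a nonzero
      coordinate \<open>X (Suc k)\<close>, which vanishes on the image of
      \<open>L k\<close>.\<close>
    define w :: "nat \<Rightarrow> 'k" where "w i = of_bool (i = Suc k)" for i
    have "w \<in> L (Suc k)" by (simp add: L_def w_def)
    moreover have "?\<phi> w \<notin> ?\<phi> ` L k"
    proof
      assume "?\<phi> w \<in> ?\<phi> ` L k"
      then obtain u where u: "u \<in> L k" "?\<phi> w = ?\<phi> u" by blast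
      have "u (Suc k) = 0" using u(1) that by (simp add: L_def)
      then have "?\<phi> w (X (Suc k)) = 0"
        using toric_point_X_eq_0_iff[OF a p, of "Suc k" n l d b c u] that u(2) by simp
      then show False
        using toric_point_X_eq_0_iff[OF a p, of "Suc k" n l d b c w] that by (simp add: w_def)
    qed
    ultimately show "?\<phi> ` L k \<noteq> ?\<phi> ` L (Suc k)" by blast
  qed
  show ?thesis
    unfolding variety_dim_def
  proof (rule antisym)
    show "Sup {enat m |m. \<exists>Z. (\<forall>i\<le>m. irreducible_closed (coords n) (Z i) \<and> Z i \<subseteq> ?V) \<and>
        (\<forall>i<m. Z i \<subset> Z (Suc i))} \<le> enat n"
    proof (rule Sup_least, clarify)
      fix m and Z :: "nat \<Rightarrow> (coord \<Rightarrow> 'k) set"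
      assume Z: "\<forall>i\<le>m. irreducible_closed (coords n) (Z i) \<and> Z i \<subseteq> ?V" "\<forall>i<m. Z i \<subset> Z (Suc i)"
      have "m \<le> card {1..n}"
      proof (rule chain_length_le)
        show "polyfun {1..n} (\<lambda>u. ?\<phi> u j)" if "j \<in> coords n" for j
          by (rule polyfun_toric_point[OF n that])
        show "irreducible_closed (coords n) (Z i)" if "i \<le> m" for i using Z(1) that by simp
        show "Z i \<subset> Z (Suc i)" if "i < m" for i using Z(2) that by simp
        show "Z m \<subseteq> range ?\<phi>" using Z(1) V by simp
      qed simp_all
      then show "enat m \<le> enat n" by simp
    qed
    \<comment> \<open>The images of \<open>L 0\<close>, ..., \<open>L n\<close> are
      \<open>n + 1\<close> sets, that is, a chain of length \<open>n\<close>.\<close>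
    show "enat n \<le> Sup {enat m |m. \<exists>Z. (\<forall>i\<le>m. irreducible_closed (coords n) (Z i) \<and> Z i \<subseteq> ?V) \<and>
        (\<forall>i<m. Z i \<subset> Z (Suc i))}"
      using irr strict V
      by (intro Sup_upper CollectI exI[of _ n] conjI exI[of _ "\<lambda>k. ?\<phi> ` L k"]) auto
  qed
qed

theorem corollary1:
  fixes n p l a d :: nat and b c :: "nat \<Rightarrow> nat"
    and V :: "(coord \<Rightarrow> 'k::alg_closed_field) set"
  assumes "n \<ge> 3" and "prime p"
    and "l > 0" and "a > 0" and "d > 0"
    and "\<forall>i \<in> {1..n - 2}. c i > 0"
    and "\<forall>i \<in> {1..n - 2}. \<not> p dvd c i"
    and "coprime a d"
    and "\<exists>g h :: nat. g > 0 \<and> h > 0 \<and> p ^ l = a * g + d * h"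
    and "V = toric_variety n p l a d b c"
    and "CHAR('k) = p"
  shows "binomial_set_theoretic_complete_intersection (coords n) V \<and>
         variety_codim (coords n) V = enat n \<and>
         (\<exists>B \<subseteq> binomials (coords n). finite B \<and> card B = n \<and> zero_locus (coords n) B = V)"
proof -
  obtain g h where gh: "g > 0" "h > 0" "p ^ l = a * g + d * h" using assms(9) by blast
  have p: "p > 0" "p ^ l > 0" using \<open>prime p\<close> prime_gt_0_nat by simp_all
  define B :: "(coord, 'k) mpoly set" where "B = toric_binomial n (p ^ l) a d b c g h ` {1..n}"
  have B: "B \<subseteq> binomials (coords n)" "finite B" "card B = n"
    using toric_binomial_in_binomials[OF assms(1) p(2) assms(4,5) gh(2) assms(6), where 'k = 'k]
      card_toric_binomials[OF assms(1) p(2) assms(4,5) gh(2) assms(6), where 'k = 'k]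
    by (auto simp: B_def)
  have zero: "zero_locus (coords n) B = V"
    unfolding B_def assms(10) by (rule zero_locus_toric_binomials) (use assms gh in auto)
  \<comment> \<open>Closedness of \<open>V\<close> is a premise of the dimension computation and
    follows from the binomial equations just found.\<close>
  have "binomials (coords n) \<subseteq> (poly_ring (coords n) :: (coord, 'k) mpoly set)"
    by (fastforce simp: binomials_def monomials_def poly_ring_def dest: subsetD[OF keys_diff] split: if_splits)
  then have "zariski_closed (coords n) V"
    using B(1) zero zariski_closed_zero_locus by blast
  then have "variety_dim (coords n) V = enat n"
    unfolding assms(10) by (rule variety_dim_toric_variety[OF assms(1) p(1) assms(4)])
  then have "variety_codim (coords n) V = enat n"
    by (simp add: variety_codim_def card_coords)
  then show ?thesis
    using B zero unfolding binomial_set_theoretic_complete_intersection_def by auto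
qed

end
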